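(* Let $\vec w=(w_1,w_2)$ and $\underline{\vec w}=(w_2,x\,w_1)$. For $n\in\mathbb N_0$ the type I linear forms and polynomials of the two systems are related by $$Q^{(n)}_{\underline{\vec w}}(y)=Q^{(n)}_{\vec w}(y)-\frac{A^{(n)}_{1,\vec w}(0)}{A^{(n+1)}_{1,\vec w}(0)}Q^{(n+1)}_{\vec w}(y),\qquad A^{(n)}_{1,\underline{\vec w}}(y)=A^{(n)}_{2,\vec w}(y)-\frac{A^{(n)}_{1,\vec w}(0)}{A^{(n+1)}_{1,\vec w}(0)}A^{(n+1)}_{2,\vec w}(y),$$ $$A^{(n)}_{2,\underline{\vec w}}(y)=\frac1y\left(A^{(n)}_{1,\vec w}(y)-\frac{A^{(n)}_{1,\vec w}(0)}{A^{(n+1)}_{1,\vec w}(0)}A^{(n+1)}_{1,\vec w}(y)\right).$$ For $n\in\mathbb N_0$ the type II polynomials satisfy $$B^{(n)}_{\underline{\vec w}}(x)=\frac{K_1^{(n+1)}(x,0)}{A^{(n)}_{1,\vec w}(0)}=\frac1x\left(B^{(n+1)}_{\vec w}(x)+\Big(\frac{A^{(n-1)}_{1,\vec w}(0)}{A^{(n)}_{1,\vec w}(0)}+T_{n,n}\Big)B^{(n)}_{\vec w}(x)-\frac{A^{(n+1)}_{1,\vec w}(0)}{A^{(n)}_{1,\vec w}(0)}T_{n+1,n-1}B^{(n-1)}_{\vec w}(x)\right).$$ For $n\in\mathbb N_0$, $$H_{\underline{\vec w},n}=-\frac{A^{(n+1)}_{1,\vec w}(0)}{A^{(n)}_{1,\vec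 w}(0)}H_{\vec w,n+1}.$$
   Context: Let $\Delta\subset\mathbb R$ be an interval, $\mu$ a measure supported on $\Delta$, and $w_1,w_2$ weight functions on $\Delta$ with all moments finite. All vectors and matrices are semi-infinite, indexed by $0,1,2,\dots$. Put $X(x)=(1,x,x^2,\dots)^\top$, $X_1(x)=(1,0,x,0,x^2,0,\dots)^\top$, $X_2(x)=(0,1,0,x,0,x^2,\dots)^\top$. For a pair of weights $\vec u=(u_1,u_2)$, the moment matrix is $g_{\vec u}=\int_\Delta X(x)\big(X_1(x)u_1(x)+X_2(x)u_2(x)\big)^\top\mathrm d\mu(x)$. It is assumed that for both $\vec u=\vec w$ and $\vec u=\underline{\vec w}$ the matrix $g_{\vec u}$ has a Gauss–Borel factorization $g_{\vec u}=S_{\vec u}^{-1}H_{\vec u}\tilde S_{\vec u}^{-\top}$ with $S_{\vec u},\tilde S_{\vec u}$ lower unitriangular and $H_{\vec u}=\operatorname{diag}(H_{\vec u,0},H_{\vec u,1},\dots)$, all entries nonzero. $B^{(n)}_{\vec u}$, $A^{(n)}_{a,\vec u}$, $Q^{(n)}_{\vec u}$ are the entries of $B_{\vec u}=S_{\vec u}X$, $A_{a,\vec u}=H_{\vec u}^{-1}\tilde S_{\vec u}X_a$ ($a\in\{1,2\}$) and $Q_{\vec u}=u_1A_{1,\vec u}+u_2A_{2,\vec u}$; quantities with index $-1$ are zero. $T=S_{\vec w}\Lambda S_{\vec w}^{-1}$, where $\Lambda$ has ones on the first superdiagonal and zeros elsewhere, and $K_1^{(n)}(x,y)=\sum_{m=0}^{n-1}B_{\vec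 w}^{(m)}(x)A_{1,\vec w}^{(m)}(y)$. Under these assumptions $A_{1,\vec w}^{(n)}(0)\ne0$ for all $n\in\mathbb N_0$, so the quotients make sense. *)

theory Defs
  imports "HOL-Analysis.Analysis"
begin

section \<open>Semi-infinite matrices and vectors\<close>

text \<open>Rows and columns are indexed by 0, 1, 2, and so on. In every product formed below each series
  has only finitely many nonzero terms, because the left or the right factor is triangular,
  Hessenberg or diagonal.\<close>

type_synonym svec = "nat \<Rightarrow> real"
type_synonym smat = "nat \<Rightarrow> nat \<Rightarrow> real"

definition smat_mult :: "smat \<Rightarrow> smat \<Rightarrow> smat" (infixl "\<odot>" 70) where
  "A \<odot> B = (\<lambda>i j. \<Sum>k. A i k * B k j)"

definition smat_vec :: "smat \<Rightarrow> svec \<Rightarrow> svec" (infixl "\<odot>v" 70) where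
  "A \<odot>v v = (\<lambda>i. \<Sum>k. A i k * v k)"

definition sdiag :: "svec \<Rightarrow> smat" where
  "sdiag h = (\<lambda>i j. if i = j then h i else 0)"

definition sident :: smat where
  "sident = sdiag (\<lambda>_. 1)"

definition stranspose :: "smat \<Rightarrow> smat" where
  "stranspose A = (\<lambda>i j. A j i)"

definition shift_mat :: smat where
  "shift_mat = (\<lambda>i j. if j = Suc i then 1 else 0)"

definition lower_unitriangular :: "smat \<Rightarrow> bool" where
  "lower_unitriangular S \<longleftrightarrow> (\<forall>i. S i i = 1) \<and> (\<forall>i j. i < j \<longrightarrow> S i j = 0)"

text \<open>The inverse in the group of lower unitriangular matrices. (Semi-infinite matrices as such do
  not form a ring, so the group in which the inverse is taken has to be named.)\<close>

definition lu_inv :: "smat \<Rightarrow> smat" where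
  "lu_inv S = (THE R. lower_unitriangular R \<and> R \<odot> S = sident \<and> S \<odot> R = sident)"

text \<open>Extension of a sequence by zero to negative indices.\<close>

definition zext :: "(nat \<Rightarrow> real) \<Rightarrow> int \<Rightarrow> real" where
  "zext f k = (if k < 0 then 0 else f (nat k))"

section \<open>Moment matrix and Gauss--Borel factorization\<close>

definition Xvec :: "real \<Rightarrow> svec" where
  "Xvec x = (\<lambda>j. x ^ j)"

definition X1vec :: "real \<Rightarrow> svec" where
  "X1vec x = (\<lambda>j. if even j then x ^ (j div 2) else 0)"

definition X2vec :: "real \<Rightarrow> svec" where
  "X2vec x = (\<lambda>j. if odd j then x ^ (j div 2) else 0)"

type_synonym weight_pair = "(real \<Rightarrow> real) \<times> (real \<Rightarrow> real)"

definition finite_moments :: "real set \<Rightarrow> real measure \<Rightarrow> (real \<Rightarrow> real) \<Rightarrow> bool" where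
  "finite_moments \<Delta> \<mu> w \<longleftrightarrow> (\<forall>k. set_integrable \<mu> \<Delta> (\<lambda>x. x ^ k * w x))"

definition moment_matrix :: "real set \<Rightarrow> real measure \<Rightarrow> weight_pair \<Rightarrow> smat" where
  "moment_matrix \<Delta> \<mu> u = (\<lambda>i j.
     LINT x:\<Delta>|\<mu>. Xvec x i * (X1vec x j * fst u x + X2vec x j * snd u x))"

definition gauss_borel :: "smat \<Rightarrow> smat \<Rightarrow> svec \<Rightarrow> smat \<Rightarrow> bool" where
  "gauss_borel g S H St \<longleftrightarrow>
     lower_unitriangular S \<and> lower_unitriangular St \<and> (\<forall>n. H n \<noteq> 0) \<and>
     g = lu_inv S \<odot> sdiag H \<odot> stranspose (lu_inv St)"

definition swapped_weights :: "weight_pair \<Rightarrow> weight_pair" where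
  "swapped_weights w = (snd w, \<lambda>x. x * fst w x)"

section \<open>Polynomials, linear forms, recurrence matrix and kernel\<close>

text \<open>Here \<open>S\<close>, \<open>H\<close>, \<open>St\<close> are the factors of a Gauss--Borel factorization.\<close>

definition typeII_B :: "smat \<Rightarrow> nat \<Rightarrow> real \<Rightarrow> real" where
  "typeII_B S n x = (S \<odot>v Xvec x) n"

definition typeI_A1 :: "svec \<Rightarrow> smat \<Rightarrow> nat \<Rightarrow> real \<Rightarrow> real" where
  "typeI_A1 H St n y = (sdiag (\<lambda>k. inverse (H k)) \<odot> St \<odot>v X1vec y) n"

definition typeI_A2 :: "svec \<Rightarrow> smat \<Rightarrow> nat \<Rightarrow> real \<Rightarrow> real" where
  "typeI_A2 H St n y = (sdiag (\<lambda>k. inverse (H k)) \<odot> St \<odot>v X2vec y) n"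

definition typeI_Q :: "weight_pair \<Rightarrow> svec \<Rightarrow> smat \<Rightarrow> nat \<Rightarrow> real \<Rightarrow> real" where
  "typeI_Q u H St n y = fst u y * typeI_A1 H St n y + snd u y * typeI_A2 H St n y"

definition recurrence_mat :: "smat \<Rightarrow> smat" where
  "recurrence_mat S = S \<odot> shift_mat \<odot> lu_inv S"

definition kernel_K1 :: "smat \<Rightarrow> svec \<Rightarrow> smat \<Rightarrow> nat \<Rightarrow> real \<Rightarrow> real \<Rightarrow> real" where
  "kernel_K1 S H St n x y = (\<Sum>m<n. typeII_B S m x * typeI_A1 H St m y)"

end

theory Submission
  imports Defs
begin

text \<open>Dropping the first column of the moment matrix of \<open>(w\<^sub>1, w\<^sub>2)\<close> gives the moment matrix of
  \<open>(w\<^sub>2, x w\<^sub>1)\<close>, and raising the row index by one amounts to raising the column index by two.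
  The rows of \<open>H\<^sup>-\<^sup>1 \<odot> St\<close> and of \<open>S\<close> are each determined by biorthogonality relations against the
  moment matrix, because its leading blocks are nonsingular. It therefore suffices to check that
  the Christoffel combinations satisfy the relations of the swapped system: the coefficient
  \<open>A\<^sub>1 n 0 / A\<^sub>1 (n + 1) 0\<close> is the one that cancels the entry in the dropped column, and
  \<open>St\<^sup>T H\<^sup>-\<^sup>1 S = g\<^sup>-\<^sup>1\<close>, truncated and read along its first row, gives the kernel. The three-term
  form then follows from \<open>x B = T B\<close>, since the sequence \<open>m \<mapsto> A\<^sub>1 m 0\<close> is annihilated by \<open>T\<close> acting
  from the right.\<close>

section \<open>Inverses of lower unitriangular matrices\<close>

lemma suminf_eq_sum_atMost:
  fixes f :: "nat \<Rightarrow> real"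
  assumes "\<And>k. N < k \<Longrightarrow> f k = 0"
  shows "(\<Sum>k. f k) = (\<Sum>k\<le>N. f k)"
  using assms by (intro suminf_finite) auto

lemma lower_unitriangular_diag [simp]: "lower_unitriangular S \<Longrightarrow> S i i = 1"
  and lower_unitriangular_zero: "lower_unitriangular S \<Longrightarrow> i < j \<Longrightarrow> S i j = 0"
  by (auto simp: lower_unitriangular_def)

lemma smat_mult_lower:
  assumes "lower_unitriangular A" "i \<le> N"
  shows "(A \<odot> B) i j = (\<Sum>k\<le>N. A i k * B k j)"
  unfolding smat_mult_def
  by (rule suminf_eq_sum_atMost) (use assms in \<open>auto simp: lower_unitriangular_zero\<close>)

text \<open>Semi-infinite products are not associative in general. Here row \<open>i\<close> of
  \<open>A\<close> and of \<open>A \<odot> B\<close> stops at column \<open>i\<close>, so every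
  outer sum is finite and two finite sums are exchanged.\<close>

lemma smat_mult_assoc_lower:
  assumes "lower_unitriangular A" "lower_unitriangular B"
  shows "(A \<odot> B) \<odot> C = A \<odot> (B \<odot> C)"
proof (intro ext)
  fix i j
  have zero: "(A \<odot> B) i k = 0" if "i < k" for k
    unfolding smat_mult_lower[OF assms(1) order.refl]
    using that by (intro sum.neutral ballI) (simp add: lower_unitriangular_zero[OF assms(2)])
  have "((A \<odot> B) \<odot> C) i j = (\<Sum>k\<le>i. (A \<odot> B) i k * C k j)"
    unfolding smat_mult_def[of "A \<odot> B"]
    by (rule suminf_eq_sum_atMost) (simp add: zero)
  also have "\<dots> = (\<Sum>k\<le>i. \<Sum>l\<le>i. A i l * B l k * C k j)"
    by (simp add: smat_mult_lower[OF assms(1) order.refl] sum_distrib_right)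
  also have "\<dots> = (\<Sum>l\<le>i. \<Sum>k\<le>i. A i l * B l k * C k j)"
    by (rule sum.swap)
  also have "\<dots> = (\<Sum>l\<le>i. A i l * (B \<odot> C) l j)"
    by (simp add: smat_mult_lower[OF assms(2), of _ i] sum_distrib_left mult.assoc)
  also have "\<dots> = (A \<odot> (B \<odot> C)) i j"
    by (simp add: smat_mult_lower[OF assms(1) order.refl])
  finally show "((A \<odot> B) \<odot> C) i j = (A \<odot> (B \<odot> C)) i j" .
qed

lemma sident_mult_left [simp]: "sident \<odot> A = A"
proof (intro ext)
  fix i j
  have "(sident \<odot> A) i j = (\<Sum>k\<le>i. sident i k * A k j)"
    unfolding smat_mult_def by (rule suminf_eq_sum_atMost) (auto simp: sident_def sdiag_def)
  then show "(sident \<odot> A) i j = A i j"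
    by (simp add: sident_def sdiag_def if_distrib [of "\<lambda>c. c * _"] cong: if_cong)
qed

lemma sident_mult_right [simp]: "A \<odot> sident = A"
proof (intro ext)
  fix i j
  have "(A \<odot> sident) i j = (\<Sum>k\<le>j. A i k * sident k j)"
    unfolding smat_mult_def by (rule suminf_eq_sum_atMost) (auto simp: sident_def sdiag_def)
  then show "(A \<odot> sident) i j = A i j"
    by (simp add: sident_def sdiag_def if_distrib [of "\<lambda>c. _ * c"] cong: if_cong)
qed

text \<open>Column \<open>j\<close> of a right inverse of \<open>S\<close>, solved downwards from
  the top row. There is no division because the diagonal of \<open>S\<close> is meant to be
  1.\<close>

function forward_subst :: "smat \<Rightarrow> smat" where
  "forward_subst S i j = (if i = j then 1 else 0) - (\<Sum>k<i. S i k * forward_subst S k j)"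
  by pat_completeness auto
termination
  by (relation "Wellfounded.measure (\<lambda>(S, i, j). i)") auto

declare forward_subst.simps [simp del]

lemma forward_subst_zero: "i < j \<Longrightarrow> forward_subst S i j = 0"
proof (induction i rule: less_induct)
  case (less i)
  then show ?case
    by (subst forward_subst.simps) simp
qed

lemma forward_subst_lower: "lower_unitriangular (forward_subst S)"
proof -
  have "forward_subst S i i = 1" for i
    by (subst forward_subst.simps) (simp add: forward_subst_zero)
  then show ?thesis
    by (simp add: lower_unitriangular_def forward_subst_zero)
qed

lemma mult_forward_subst:
  assumes "lower_unitriangular S"
  shows "S \<odot> forward_subst S = sident"
proof (intro ext)
  fix i j
  have "(S \<odot> forward_subst S) i j = (\<Sum>k<i. S i k * forward_subst S k j) + forward_subst S i j"
    by (simp add: smat_mult_lower[OF assms order.refl] assms flip: lessThan_Suc_atMost)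
  then show "(S \<odot> forward_subst S) i j = sident i j"
    by (subst (asm) (2) forward_subst.simps) (simp add: sident_def sdiag_def)
qed

text \<open>Forward substitution gives a right inverse \<open>R\<close> of \<open>S\<close>. As
  \<open>R\<close> has a right inverse too, associativity identifies that one with \<open>S\<close>,
  so \<open>R\<close> is two-sided; its uniqueness gives the \<open>THE\<close> in
  \<open>lu_inv\<close> its value.\<close>

lemma lu_inv:
  assumes "lower_unitriangular S"
  shows lu_inv_lower: "lower_unitriangular (lu_inv S)"
    and lu_inv_left: "lu_inv S \<odot> S = sident"
    and lu_inv_right: "S \<odot> lu_inv S = sident"
proof -
  define R where "R = forward_subst S"
  have R: "lower_unitriangular R" "S \<odot> R = sident"
    using assms by (simp_all add: R_def forward_subst_lower mult_forward_subst)
  have "S = S \<odot> (R \<odot> forward_subst R)"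
    by (simp add: mult_forward_subst R)
  also have "\<dots> = forward_subst R"
    by (simp add: R flip: smat_mult_assoc_lower[OF assms R(1)])
  finally have RS: "R \<odot> S = sident"
    using mult_forward_subst[OF R(1)] by simp
  have uniq: "R' = R" if "lower_unitriangular R'" "R' \<odot> S = sident" for R'
    using smat_mult_assoc_lower[OF that(1) assms, of R] that(2) R(2) by simp
  have "lower_unitriangular (lu_inv S) \<and> lu_inv S \<odot> S = sident \<and> S \<odot> lu_inv S = sident"
    unfolding lu_inv_def by (rule theI[of _ R]) (use R RS uniq in blast)+
  then show "lower_unitriangular (lu_inv S)" "lu_inv S \<odot> S = sident" "S \<odot> lu_inv S = sident"
    by auto
qed

lemma lu_inv_right_sum:
  assumes "lower_unitriangular S" "i \<le> N"
  shows "(\<Sum>k\<le>N. S i k * lu_inv S k j) = (if i = j then 1 else 0)"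
  using smat_mult_lower[OF assms, of "lu_inv S" j] lu_inv_right[OF assms(1)]
  by (simp add: sident_def sdiag_def)

lemma lu_inv_left_sum:
  assumes "lower_unitriangular S" "i \<le> N"
  shows "(\<Sum>k\<le>N. lu_inv S i k * S k j) = (if i = j then 1 else 0)"
  using smat_mult_lower[OF lu_inv_lower[OF assms(1)] assms(2), of S j] lu_inv_left[OF assms(1)]
  by (simp add: sident_def sdiag_def)

section \<open>Biorthogonality relations of a Gauss--Borel factorization\<close>

lemma gauss_borelD:
  assumes "gauss_borel g S H St"
  shows "lower_unitriangular S" "lower_unitriangular St" "H n \<noteq> 0"
  using assms by (auto simp: gauss_borel_def)

text \<open>The left factor is lower triangular, so the series stops at the row index and
  \<open>j\<close> stays arbitrary.\<close>

lemma gauss_borel_entry: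
  assumes "gauss_borel g S H St" "i \<le> N"
  shows "g i j = (\<Sum>k\<le>N. lu_inv S i k * H k * lu_inv St j k)"
proof -
  have R: "lower_unitriangular (lu_inv S)"
    using assms by (intro lu_inv_lower gauss_borelD)
  have LD: "(lu_inv S \<odot> sdiag H) i k = lu_inv S i k * H k" for k
  proof -
    have "(lu_inv S \<odot> sdiag H) i k = (\<Sum>l\<le>k. lu_inv S i l * sdiag H l k)"
      unfolding smat_mult_def by (rule suminf_eq_sum_atMost) (auto simp: sdiag_def)
    then show ?thesis
      by (simp add: sdiag_def if_distrib [of "\<lambda>c. _ * c"] cong: if_cong)
  qed
  have "g i j = (lu_inv S \<odot> sdiag H \<odot> stranspose (lu_inv St)) i j"
    using assms(1) by (simp add: gauss_borel_def)
  also have "\<dots> = (\<Sum>k\<le>N. (lu_inv S \<odot> sdiag H) i k * stranspose (lu_inv St) k j)"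
    unfolding smat_mult_def[of "lu_inv S \<odot> sdiag H"]
    by (rule suminf_eq_sum_atMost) (use assms(2) in \<open>simp add: LD lower_unitriangular_zero[OF R]\<close>)
  finally show ?thesis
    by (simp add: LD stranspose_def)
qed

text \<open>Truncation by the other triangular factor: the series stops at the column index and
  \<open>i\<close> stays arbitrary.\<close>

lemma gauss_borel_entry':
  assumes "gauss_borel g S H St" "j \<le> N"
  shows "g i j = (\<Sum>k\<le>N. lu_inv S i k * H k * lu_inv St j k)"
proof -
  have Rt: "lower_unitriangular (lu_inv St)"
    using assms by (intro lu_inv_lower gauss_borelD)
  have "g i j = (\<Sum>k\<le>max i N. lu_inv S i k * H k * lu_inv St j k)"
    by (rule gauss_borel_entry[OF assms(1)]) simp
  also have "\<dots> = (\<Sum>k\<le>N. lu_inv S i k * H k * lu_inv St j k)"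
    by (rule sum.mono_neutral_right) (use assms(2) in \<open>auto simp: lower_unitriangular_zero[OF Rt]\<close>)
  finally show ?thesis .
qed

text \<open>This is \<open>S g = H\<close> times the transpose of \<open>lu_inv St\<close>. That
  product is upper triangular, so row \<open>m\<close> of \<open>S\<close> is orthogonal to all
  columns \<open>j < m\<close> of \<open>g\<close>.\<close>

lemma gauss_borel_row:
  assumes gb: "gauss_borel g S H St" and "m \<le> N"
  shows "(\<Sum>i\<le>N. S m i * g i j) = H m * lu_inv St j m"
proof -
  have "(\<Sum>i\<le>N. S m i * g i j)
      = (\<Sum>i\<le>N. \<Sum>k\<le>N. S m i * lu_inv S i k * (H k * lu_inv St j k))"
    by (intro sum.cong refl) (simp add: gauss_borel_entry[OF gb, of _ N] sum_distrib_left mult_ac)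
  also have "\<dots> = (\<Sum>k\<le>N. (\<Sum>i\<le>N. S m i * lu_inv S i k) * (H k * lu_inv St j k))"
    by (subst sum.swap) (simp add: sum_distrib_right)
  also have "\<dots> = H m * lu_inv St j m"
    using assms(2)
    by (simp add: lu_inv_right_sum[OF gauss_borelD(1)[OF gb]] if_distrib [of "\<lambda>c. c * _"] cong: if_cong)
  finally show ?thesis .
qed

lemma gauss_borel_column:
  assumes gb: "gauss_borel g S H St" and "m \<le> N"
  shows "(\<Sum>j\<le>N. g i j * St m j) = H m * lu_inv S i m"
proof -
  have "(\<Sum>j\<le>N. g i j * St m j)
      = (\<Sum>j\<le>N. \<Sum>k\<le>N. St m j * lu_inv St j k * (H k * lu_inv S i k))"
    by (intro sum.cong refl)
      (simp add: gauss_borel_entry'[OF gb, of _ N] sum_distrib_left sum_distrib_right mult_ac)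
  also have "\<dots> = (\<Sum>k\<le>N. (\<Sum>j\<le>N. St m j * lu_inv St j k) * (H k * lu_inv S i k))"
    by (subst sum.swap) (simp add: sum_distrib_right)
  also have "\<dots> = H m * lu_inv S i m"
    using assms(2)
    by (simp add: lu_inv_right_sum[OF gauss_borelD(2)[OF gb]] if_distrib [of "\<lambda>c. c * _"] cong: if_cong)
  finally show ?thesis .
qed

text \<open>The leading block of size \<open>N + 1\<close> is injective: applying the rows of
  \<open>S\<close> to \<open>g v = 0\<close> and dividing by \<open>H m\<close> shows that
  \<open>v\<close> times \<open>lu_inv St\<close> vanishes, and multiplying by \<open>St\<close>
  recovers \<open>v\<close>.\<close>

lemma gauss_borel_kernel_right:
  assumes gb: "gauss_borel g S H St"
    and orth: "\<And>i. i \<le> N \<Longrightarrow> (\<Sum>l\<le>N. g i l * v l) = 0" and "j \<le> N"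
  shows "v j = 0"
proof -
  have Rtv: "(\<Sum>l\<le>N. v l * lu_inv St l m) = 0" if "m \<le> N" for m
  proof -
    have "H m * (\<Sum>l\<le>N. v l * lu_inv St l m) = (\<Sum>l\<le>N. v l * (H m * lu_inv St l m))"
      by (simp add: sum_distrib_left mult_ac)
    also have "\<dots> = (\<Sum>l\<le>N. \<Sum>i\<le>N. S m i * (g i l * v l))"
      unfolding gauss_borel_row[OF gb that, symmetric] by (simp add: sum_distrib_left mult_ac)
    also have "\<dots> = (\<Sum>i\<le>N. S m i * (\<Sum>l\<le>N. g i l * v l))"
      by (subst sum.swap) (simp add: sum_distrib_left)
    also have "\<dots> = 0"
      by (simp add: orth)
    finally show ?thesis
      using gauss_borelD(3)[OF gb] by simp
  qed
  have "v j = (\<Sum>l\<le>N. v l * (\<Sum>m\<le>N. lu_inv St l m * St m j))"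
    using assms(3)
    by (simp add: lu_inv_left_sum[OF gauss_borelD(2)[OF gb]] if_distrib [of "\<lambda>c. _ * c"] cong: if_cong)
  also have "\<dots> = (\<Sum>m\<le>N. (\<Sum>l\<le>N. v l * lu_inv St l m) * St m j)"
    by (simp add: sum_distrib_left sum_distrib_right mult.assoc) (rule sum.swap)
  also have "\<dots> = 0"
    by (simp add: Rtv)
  finally show ?thesis .
qed

text \<open>The mirror image, with the rows of \<open>St\<close> applied first and \<open>S\<close>
  recovering \<open>u\<close>.\<close>

lemma gauss_borel_kernel_left:
  assumes gb: "gauss_borel g S H St"
    and orth: "\<And>j. j \<le> N \<Longrightarrow> (\<Sum>i\<le>N. u i * g i j) = 0" and "k \<le> N"
  shows "u k = 0"
proof -
  have uR: "(\<Sum>i\<le>N. u i * lu_inv S i m) = 0" if "m \<le> N" for m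
  proof -
    have "H m * (\<Sum>i\<le>N. u i * lu_inv S i m) = (\<Sum>i\<le>N. u i * (H m * lu_inv S i m))"
      by (simp add: sum_distrib_left mult_ac)
    also have "\<dots> = (\<Sum>i\<le>N. \<Sum>j\<le>N. St m j * (u i * g i j))"
      unfolding gauss_borel_column[OF gb that, symmetric] by (simp add: sum_distrib_left mult_ac)
    also have "\<dots> = (\<Sum>j\<le>N. St m j * (\<Sum>i\<le>N. u i * g i j))"
      by (subst sum.swap) (simp add: sum_distrib_left)
    also have "\<dots> = 0"
      by (simp add: orth)
    finally show ?thesis
      using gauss_borelD(3)[OF gb] by simp
  qed
  have "u k = (\<Sum>i\<le>N. u i * (\<Sum>m\<le>N. lu_inv S i m * S m k))"
    using assms(3)
    by (simp add: lu_inv_left_sum[OF gauss_borelD(1)[OF gb]] if_distrib [of "\<lambda>c. _ * c"] cong: if_cong)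
  also have "\<dots> = (\<Sum>m\<le>N. (\<Sum>i\<le>N. u i * lu_inv S i m) * S m k)"
    by (simp add: sum_distrib_left sum_distrib_right mult.assoc) (rule sum.swap)
  also have "\<dots> = 0"
    by (simp add: uR)
  finally show ?thesis .
qed

section \<open>Polynomials and recurrence matrix as finite sums\<close>

lemma typeII_B_sum:
  assumes "lower_unitriangular S" "n \<le> N"
  shows "typeII_B S n x = (\<Sum>k\<le>N. S n k * x ^ k)"
  unfolding typeII_B_def smat_vec_def Xvec_def
  by (rule suminf_eq_sum_atMost) (use assms in \<open>simp add: lower_unitriangular_zero\<close>)

lemma sdiag_smat_vec_sum:
  assumes "lower_unitriangular St" "n \<le> N"
  shows "(sdiag h \<odot> St \<odot>v v) n = (\<Sum>j\<le>N. h n * St n j * v j)"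
proof -
  have "(sdiag h \<odot> St) n k = h n * St n k" for k
  proof -
    have "(sdiag h \<odot> St) n k = (\<Sum>l\<le>n. sdiag h n l * St l k)"
      unfolding smat_mult_def by (rule suminf_eq_sum_atMost) (auto simp: sdiag_def)
    then show ?thesis
      by (simp add: sdiag_def if_distrib [of "\<lambda>c. c * _"] cong: if_cong)
  qed
  then show ?thesis
    unfolding smat_vec_def
    by (subst suminf_eq_sum_atMost[of N]) (use assms in \<open>simp_all add: lower_unitriangular_zero\<close>)
qed

lemma typeI_A1_sum:
  assumes "lower_unitriangular St" "n \<le> N"
  shows "typeI_A1 H St n y = (\<Sum>j\<le>N. inverse (H n) * St n j * X1vec y j)"
  by (simp add: typeI_A1_def sdiag_smat_vec_sum[OF assms])

lemma typeI_A2_sum: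
  assumes "lower_unitriangular St" "n \<le> N"
  shows "typeI_A2 H St n y = (\<Sum>j\<le>N. inverse (H n) * St n j * X2vec y j)"
  by (simp add: typeI_A2_def sdiag_smat_vec_sum[OF assms])

lemma X1vec_zero: "X1vec 0 j = (if j = 0 then 1 else 0)"
  by (auto simp: X1vec_def elim!: evenE)

text \<open>Raising the index by one exchanges the two vectors up to a factor \<open>y\<close>; this
  is where the pair \<open>(w\<^sub>2, x w\<^sub>1)\<close> comes from.\<close>

lemma X1vec_Suc: "X1vec y (Suc j) = y * X2vec y j"
  by (auto simp: X1vec_def X2vec_def elim!: oddE)

lemma X2vec_Suc: "X2vec y (Suc j) = X1vec y j"
  by (auto simp: X1vec_def X2vec_def elim!: evenE)

text \<open>At 0 only the constant term survives, so these values form the first column of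
  \<open>St\<close> scaled by the inverses of \<open>H\<close>.\<close>

lemma typeI_A1_zero:
  assumes "lower_unitriangular St"
  shows "typeI_A1 H St n 0 = inverse (H n) * St n 0"
  by (simp add: typeI_A1_sum[OF assms order.refl] X1vec_zero if_distrib [of "\<lambda>c. _ * c"] cong: if_cong)

section \<open>The recurrence matrix: Hessenberg shape, action on type II polynomials, left null
  vector\<close>

lemma recurrence_mat_sum:
  assumes S: "lower_unitriangular S" and "m \<le> N"
  shows "recurrence_mat S m k = (\<Sum>l\<le>N. S m l * lu_inv S (Suc l) k)"
proof -
  have shift: "(S \<odot> shift_mat) i j = (case j of 0 \<Rightarrow> 0 | Suc l \<Rightarrow> S i l)" for i j
  proof -
    have "(S \<odot> shift_mat) i j = (\<Sum>l\<le>j. S i l * shift_mat l j)"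
      unfolding smat_mult_def by (rule suminf_eq_sum_atMost) (auto simp: shift_mat_def)
    then show ?thesis
      by (auto simp: shift_mat_def if_distrib [of "\<lambda>c. _ * c"] split: nat.split cong: if_cong)
  qed
  \<comment> \<open>The shift moves row \<open>m\<close> one place to the right, so the range ends
    at \<open>Suc N\<close> and its term at 0 vanishes.\<close>
  have "recurrence_mat S m k = (\<Sum>j\<le>Suc N. (S \<odot> shift_mat) m j * lu_inv S j k)"
    unfolding recurrence_mat_def smat_mult_def[of "S \<odot> shift_mat"]
    by (rule suminf_eq_sum_atMost)
      (use assms in \<open>auto simp: shift lower_unitriangular_zero split: nat.split\<close>)
  then show ?thesis
    by (simp add: sum.atMost_Suc_shift shift del: sum.atMost_Suc)
qed

lemma recurrence_mat_superdiag:
  assumes "lower_unitriangular S"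
  shows "recurrence_mat S m (Suc m) = 1"
proof -
  have "recurrence_mat S m (Suc m) = (\<Sum>l\<le>m. if l = m then 1 else 0)"
    unfolding recurrence_mat_sum[OF assms order.refl]
    by (intro sum.cong refl)
      (use assms lu_inv_lower[OF assms] in \<open>auto simp: lower_unitriangular_zero\<close>)
  then show ?thesis by simp
qed

lemma recurrence_mat_zero:
  assumes "lower_unitriangular S" "Suc m < k"
  shows "recurrence_mat S m k = 0"
  unfolding recurrence_mat_sum[OF assms(1) order.refl]
  by (intro sum.neutral ballI)
    (use assms in \<open>simp add: lower_unitriangular_zero[OF lu_inv_lower[OF assms(1)]]\<close>)

text \<open>Multiplication by \<open>x\<close> shifts the vector of powers. Each power
  \<open>x ^ l\<close> is expanded in the \<open>typeII_B S k x\<close> by \<open>lu_inv S\<close>,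
  which turns the shift into \<open>recurrence_mat S\<close>.\<close>

lemma recurrence_typeII_B:
  assumes S: "lower_unitriangular S" and "m \<le> N"
  shows "x * typeII_B S m x = (\<Sum>k\<le>Suc N. recurrence_mat S m k * typeII_B S k x)"
proof -
  have RB: "(\<Sum>k\<le>Suc N. lu_inv S l k * typeII_B S k x) = x ^ l" if "l \<le> Suc N" for l
  proof -
    have "(\<Sum>k\<le>Suc N. lu_inv S l k * typeII_B S k x)
        = (\<Sum>k\<le>Suc N. \<Sum>j\<le>Suc N. lu_inv S l k * S k j * x ^ j)"
      by (intro sum.cong refl)
        (simp add: typeII_B_sum[OF S, of _ "Suc N"] sum_distrib_left mult.assoc del: sum.atMost_Suc)
    also have "\<dots> = (\<Sum>j\<le>Suc N. (\<Sum>k\<le>Suc N. lu_inv S l k * S k j) * x ^ j)"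
      by (subst sum.swap) (simp add: sum_distrib_right del: sum.atMost_Suc)
    also have "\<dots> = x ^ l"
      using that
      by (simp add: lu_inv_left_sum[OF S that] if_distrib [of "\<lambda>c. c * _"]
          del: sum.atMost_Suc cong: if_cong)
    finally show ?thesis .
  qed
  have "x * typeII_B S m x = (\<Sum>l\<le>N. S m l * x ^ Suc l)"
    by (simp add: typeII_B_sum[OF assms] sum_distrib_left mult_ac)
  also have "\<dots> = (\<Sum>l\<le>N. \<Sum>k\<le>Suc N. S m l * lu_inv S (Suc l) k * typeII_B S k x)"
    by (intro sum.cong refl) (simp add: sum_distrib_left mult.assoc del: sum.atMost_Suc power_Suc flip: RB)
  also have "\<dots> = (\<Sum>k\<le>Suc N. recurrence_mat S m k * typeII_B S k x)"
    by (subst sum.swap) (simp add: recurrence_mat_sum[OF assms] sum_distrib_right del: sum.atMost_Suc)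
  finally show ?thesis .
qed

text \<open>The hypothesis on \<open>g\<close> is the symmetry \<open>\<Lambda> g = g (\<Lambda>\<^sup>T)\<^sup>2\<close> of the moment matrix; it turns
  \<open>T = S \<Lambda> S\<^sup>-\<^sup>1\<close> into \<open>H St\<^sup>-\<^sup>T (\<Lambda>\<^sup>T)\<^sup>2 St\<^sup>T H\<^sup>-\<^sup>1\<close>.\<close>

lemma recurrence_mat_annihilates:
  assumes gb: "gauss_borel g S H St"
    and sym: "\<And>i j. g (Suc i) j = g i (Suc (Suc j))"
    and "Suc (Suc k) \<le> N"
  shows "(\<Sum>m\<le>N. typeI_A1 H St m 0 * recurrence_mat S m k) = 0"
proof -
  note SD = gauss_borelD[OF gb]
  \<comment> \<open>Writing \<open>lu_inv S\<close> through \<open>g\<close> lets \<open>sym\<close>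
    trade the row index \<open>Suc l\<close> for the column index
    \<open>Suc (Suc j)\<close>.\<close>
  have R: "lu_inv S i k = inverse (H k) * (\<Sum>j\<le>k. g i j * St k j)" for i
    using gauss_borel_column[OF gb order.refl, of i k] SD(3)[of k] by simp
  have T: "recurrence_mat S m k
      = (\<Sum>j\<le>k. inverse (H k) * St k j * (H m * lu_inv St (Suc (Suc j)) m))" if "m \<le> N" for m
  proof -
    have "recurrence_mat S m k
        = (\<Sum>l\<le>N. \<Sum>j\<le>k. inverse (H k) * St k j * (S m l * g l (Suc (Suc j))))"
      by (simp add: recurrence_mat_sum[OF SD(1) that] R sym sum_distrib_left mult_ac)
    also have "\<dots> = (\<Sum>j\<le>k. inverse (H k) * St k j * (\<Sum>l\<le>N. S m l * g l (Suc (Suc j))))"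
      by (subst sum.swap) (simp add: sum_distrib_left)
    finally show ?thesis
      by (simp add: gauss_borel_row[OF gb that])
  qed
  have "(\<Sum>m\<le>N. typeI_A1 H St m 0 * recurrence_mat S m k)
      = (\<Sum>m\<le>N. \<Sum>j\<le>k. inverse (H k) * St k j * (lu_inv St (Suc (Suc j)) m * St m 0))"
    using SD(3) by (intro sum.cong refl)
      (simp add: T typeI_A1_zero[OF SD(2)] sum_distrib_left field_simps)
  also have "\<dots> = (\<Sum>j\<le>k. inverse (H k) * St k j * (\<Sum>m\<le>N. lu_inv St (Suc (Suc j)) m * St m 0))"
    by (subst sum.swap) (simp add: sum_distrib_left)
  \<comment> \<open>The inner sums are the entries of \<open>lu_inv St \<odot> St\<close> at row
    \<open>j + 2\<close> and column 0, off the diagonal; \<open>k + 2 \<le> N\<close> keeps these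
    rows within the range.\<close>
  also have "\<dots> = 0"
    using assms(3) by (intro sum.neutral ballI) (simp add: lu_inv_left_sum[OF SD(2)])
  finally show ?thesis .
qed

section \<open>The factorizations of a matrix and of the matrix without its first column\<close>

text \<open>If \<open>St n 0\<close> were 0, the other entries of row \<open>n\<close> of
  \<open>St\<close> would form a null vector of the leading block of size \<open>n\<close> of
  \<open>g'\<close>, contradicting \<open>St n n = 1\<close>.\<close>

lemma typeI_A1_zero_nonzero:
  assumes gb: "gauss_borel g S H St" and gb': "gauss_borel g' S' H' St'"
    and shift: "\<And>i j. g' i j = g i (Suc j)"
  shows "typeI_A1 H St n 0 \<noteq> 0"
proof
  note SD = gauss_borelD[OF gb]
  assume "typeI_A1 H St n 0 = 0"
  then have z: "St n 0 = 0"
    using SD(3) by (simp add: typeI_A1_zero[OF SD(2)])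
  with SD(2) obtain N where n: "n = Suc N"
    by (cases n) auto
  have "(\<Sum>l\<le>N. g' i l * St n (Suc l)) = 0" if "i \<le> N" for i
  proof -
    have "(\<Sum>l\<le>N. g' i l * St n (Suc l)) = (\<Sum>l\<le>n. g i l * St n l)"
      by (simp add: n shift z[unfolded n] sum.atMost_Suc_shift del: sum.atMost_Suc)
    also have "\<dots> = 0"
      using that lu_inv_lower[OF SD(1)]
      by (simp add: gauss_borel_column[OF gb order.refl] lower_unitriangular_zero n del: sum.atMost_Suc)
    finally show ?thesis .
  qed
  from gauss_borel_kernel_right[OF gb' this, of N] show False
    using SD(2) by (simp add: n)
qed

text \<open>Both sides have support in \<open>l \<le> n\<close> and the same products with the rows
  \<open>i \<le> n\<close> of \<open>g'\<close>, so injectivity of that block makes them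
  equal.\<close>

lemma typeI_row_shifted:
  assumes gb: "gauss_borel g S H St" and gb': "gauss_borel g' S' H' St'"
    and shift: "\<And>i j. g' i j = g i (Suc j)"
  defines "c \<equiv> \<lambda>n. typeI_A1 H St n 0 / typeI_A1 H St (Suc n) 0"
  shows "inverse (H' n) * St' n l
    = inverse (H n) * St n (Suc l) - c n * (inverse (H (Suc n)) * St (Suc n) (Suc l))"
proof -
  note SD = gauss_borelD[OF gb] and SD' = gauss_borelD[OF gb']
  define P where "P = (\<lambda>m j. inverse (H m) * St m j)"
  have gP: "(\<Sum>j\<le>N. g i j * P m j) = lu_inv S i m" if "m \<le> N" for i m N
  proof -
    have "(\<Sum>j\<le>N. g i j * P m j) = inverse (H m) * (\<Sum>j\<le>N. g i j * St m j)"
      by (simp add: P_def sum_distrib_left mult_ac)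
    then show ?thesis
      using SD(3)[of m] by (simp add: gauss_borel_column[OF gb that])
  qed
  have gP': "(\<Sum>j\<le>n. g' i j * (inverse (H' n) * St' n j)) = lu_inv S' i n" for i
  proof -
    have "(\<Sum>j\<le>n. g' i j * (inverse (H' n) * St' n j))
        = inverse (H' n) * (\<Sum>j\<le>n. g' i j * St' n j)"
      by (simp add: sum_distrib_left mult_ac)
    then show ?thesis
      using SD'(3)[of n] by (simp add: gauss_borel_column[OF gb'])
  qed
  \<comment> \<open>The combination vanishes in column 0, so a sum against \<open>g'\<close> is a
    full sum against \<open>g\<close>.\<close>
  have c: "P n 0 = c n * P (Suc n) 0"
    using typeI_A1_zero_nonzero[OF gb gb' shift, of "Suc n"]
    by (simp add: c_def P_def typeI_A1_zero[OF SD(2)])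
  define v where "v = (\<lambda>j. inverse (H' n) * St' n j - (P n (Suc j) - c n * P (Suc n) (Suc j)))"
  have "v l = 0"
  proof (cases "l \<le> n")
    case True
    have "(\<Sum>j\<le>n. g' i j * v j) = 0" if "i \<le> n" for i
    proof -
      have "(\<Sum>j\<le>n. g' i j * (P n (Suc j) - c n * P (Suc n) (Suc j)))
          = (\<Sum>j\<le>Suc n. g i j * (P n j - c n * P (Suc n) j))"
        by (simp add: sum.atMost_Suc_shift shift c del: sum.atMost_Suc)
      also have "\<dots> = (\<Sum>j\<le>Suc n. g i j * P n j) - c n * (\<Sum>j\<le>Suc n. g i j * P (Suc n) j)"
        by (simp add: sum_subtractf sum_distrib_left algebra_simps del: sum.atMost_Suc)
      also have "\<dots> = lu_inv S i n - c n * lu_inv S i (Suc n)"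
        by (subst (1 2) gP) auto
      \<comment> \<open>For \<open>i \<le> n\<close> the entry in column \<open>Suc n\<close> is 0,
        and both inverses have the same entry in column \<open>n\<close>: 1 if \<open>i = n\<close>,
        else 0.\<close>
      also have "\<dots> = lu_inv S' i n"
        using that lu_inv_lower[OF SD(1)] lu_inv_lower[OF SD'(1)]
        by (cases "i = n") (simp_all add: lower_unitriangular_zero)
      finally show ?thesis
        using gP'[of i] by (simp add: v_def right_diff_distrib sum_subtractf)
    qed
    from gauss_borel_kernel_right[OF gb' this True] show ?thesis .
  next
    case False
    then show ?thesis
      by (simp add: v_def P_def lower_unitriangular_zero SD(2) SD'(2))
  qed
  then show ?thesis
    by (simp add: v_def P_def)
qed

text \<open>The right-hand side is the first row of the transpose of \<open>St\<close> times the
  inverse of \<open>H\<close> times \<open>S\<close>, truncated at \<open>n\<close>. It shares its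
  leading coefficient and its orthogonality to the first \<open>n\<close> columns of
  \<open>g'\<close> with the left-hand side.\<close>

lemma typeII_row_shifted:
  assumes gb: "gauss_borel g S H St" and gb': "gauss_borel g' S' H' St'"
    and shift: "\<And>i j. g' i j = g i (Suc j)"
  shows "typeI_A1 H St n 0 * S' n k = (\<Sum>m\<le>n. typeI_A1 H St m 0 * S m k)"
proof -
  note SD = gauss_borelD[OF gb] and SD' = gauss_borelD[OF gb']
  define a where "a = (\<lambda>m. typeI_A1 H St m 0)"
  have a: "a m = inverse (H m) * St m 0" for m
    by (simp add: a_def typeI_A1_zero[OF SD(2)])
  define u where "u = (\<lambda>k. a n * S' n k - (\<Sum>m\<le>n. a m * S m k))"
  have u_ge: "u k = 0" if "n \<le> k" for k
  proof (cases "k = n")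
    case True
    have "(\<Sum>m\<le>n. a m * S m n) = (\<Sum>m\<le>n. if m = n then a n else 0)"
      by (intro sum.cong refl) (auto simp: SD(1) lower_unitriangular_zero)
    then show ?thesis
      by (simp add: u_def True SD'(1))
  next
    case False
    with that show ?thesis
      by (simp add: u_def lower_unitriangular_zero SD(1) SD'(1))
  qed
  \<comment> \<open>These are \<open>n\<close> conditions; since \<open>u n = 0\<close>, they meet
    just \<open>n\<close> unknowns, which the block of size \<open>n\<close> determines.\<close>
  have orth: "(\<Sum>k\<le>n. u k * g' k j) = 0" if "j < n" for j
  proof -
    have "(\<Sum>k\<le>n. \<Sum>m\<le>n. a m * (S m k * g' k j)) = (\<Sum>m\<le>n. a m * (\<Sum>k\<le>n. S m k * g' k j))"
      by (subst sum.swap) (simp add: sum_distrib_left)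
    also have "\<dots> = (\<Sum>m\<le>n. lu_inv St (Suc j) m * St m 0)"
      using SD(3) by (intro sum.cong refl) (simp add: shift gauss_borel_row[OF gb] a)
    also have "\<dots> = 0"
      using that by (simp add: lu_inv_left_sum[OF SD(2)])
    finally have 1: "(\<Sum>k\<le>n. \<Sum>m\<le>n. a m * (S m k * g' k j)) = 0" .
    have 2: "(\<Sum>k\<le>n. S' n k * g' k j) = 0"
      using that lu_inv_lower[OF SD'(2)]
      by (simp add: gauss_borel_row[OF gb'] lower_unitriangular_zero)
    have "(\<Sum>k\<le>n. u k * g' k j)
        = a n * (\<Sum>k\<le>n. S' n k * g' k j) - (\<Sum>k\<le>n. \<Sum>m\<le>n. a m * (S m k * g' k j))"
      by (simp add: u_def sum_distrib_left sum_distrib_right left_diff_distrib sum_subtractf mult.assoc)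
    then show ?thesis
      by (simp add: 1 2)
  qed
  have "u k = 0"
  proof (cases "n \<le> k")
    case False
    then obtain N where n: "n = Suc N" "k \<le> N"
      by (cases n) auto
    have "(\<Sum>i\<le>N. u i * g' i j) = 0" if "j \<le> N" for j
      using orth[of j] that u_ge[of n] by (simp add: n(1))
    from gauss_borel_kernel_left[OF gb' this n(2)] show ?thesis .
  qed (rule u_ge)
  then show ?thesis
    by (simp add: u_def a_def)
qed

lemma typeII_B_shifted:
  assumes gb: "gauss_borel g S H St" and gb': "gauss_borel g' S' H' St'"
    and shift: "\<And>i j. g' i j = g i (Suc j)"
  shows "typeI_A1 H St n 0 * typeII_B S' n x = kernel_K1 S H St (Suc n) x 0"
proof -
  note SD = gauss_borelD[OF gb] and SD' = gauss_borelD[OF gb']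
  have "typeI_A1 H St n 0 * typeII_B S' n x
      = (\<Sum>k\<le>n. typeI_A1 H St n 0 * S' n k * x ^ k)"
    by (simp add: typeII_B_sum[OF SD'(1) order.refl] sum_distrib_left mult.assoc)
  also have "\<dots> = (\<Sum>k\<le>n. \<Sum>m\<le>n. S m k * x ^ k * typeI_A1 H St m 0)"
    unfolding typeII_row_shifted[OF gb gb' shift] by (simp add: sum_distrib_left sum_distrib_right mult_ac)
  also have "\<dots> = (\<Sum>m\<le>n. typeII_B S m x * typeI_A1 H St m 0)"
    by (subst sum.swap) (simp add: typeII_B_sum[OF SD(1), of _ n] sum_distrib_right)
  finally show ?thesis
    by (simp add: kernel_K1_def flip: lessThan_Suc_atMost)
qed

text \<open>Multiplying by \<open>x\<close> replaces the coefficients \<open>a\<close> by truncated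
  column sums \<open>C k\<close> of \<open>a\<close> times \<open>T\<close>. Full column sums
  vanish, which removes \<open>k < n - 1\<close>; for \<open>k = n - 1\<close> only the term
  \<open>m = n + 1\<close> is missing; for \<open>k \<ge> n\<close> the Hessenberg shape leaves at
  most two terms.\<close>

lemma kernel_K1_three_term:
  assumes gb: "gauss_borel g S H St"
    and sym: "\<And>i j. g (Suc i) j = g i (Suc (Suc j))"
  defines "a \<equiv> \<lambda>m. typeI_A1 H St m 0"
  shows "x * kernel_K1 S H St (Suc n) x 0
    = a n * typeII_B S (Suc n) x
      + (zext a (int n - 1) + a n * recurrence_mat S n n) * typeII_B S n x
      - a (Suc n) * zext (recurrence_mat S (Suc n)) (int n - 1)
          * zext (\<lambda>m. typeII_B S m x) (int n - 1)"
proof -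
  note SD = gauss_borelD[OF gb]
  define T where "T = recurrence_mat S"
  define C where "C = (\<lambda>k. \<Sum>m\<le>n. a m * T m k)"
  have "x * kernel_K1 S H St (Suc n) x 0 = (\<Sum>m\<le>n. a m * (x * typeII_B S m x))"
    by (simp add: kernel_K1_def a_def sum_distrib_left mult_ac lessThan_Suc_atMost del: sum.lessThan_Suc)
  also have "\<dots> = (\<Sum>m\<le>n. \<Sum>k\<le>Suc n. a m * T m k * typeII_B S k x)"
    by (intro sum.cong refl)
      (simp add: recurrence_typeII_B[OF SD(1), of _ n] T_def sum_distrib_left mult.assoc
        del: sum.atMost_Suc)
  also have "\<dots> = (\<Sum>k\<le>Suc n. C k * typeII_B S k x)"
    by (subst sum.swap) (simp add: C_def sum_distrib_right del: sum.atMost_Suc)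
  finally have K: "x * kernel_K1 S H St (Suc n) x 0 = (\<Sum>k\<le>Suc n. C k * typeII_B S k x)" .
  have annih: "(\<Sum>m\<le>N. a m * T m k) = 0" if "Suc (Suc k) \<le> N" for k N
    using recurrence_mat_annihilates[OF gb sym that] by (simp add: a_def T_def)
  have T_sup: "T m (Suc m) = 1" and T_zero: "Suc m < k \<Longrightarrow> T m k = 0" for m k
    by (simp_all add: T_def recurrence_mat_superdiag recurrence_mat_zero SD(1))
  have C_Suc: "C (Suc n) = a n"
  proof -
    have "C (Suc n) = (\<Sum>m<n. a m * T m (Suc n)) + a n"
      by (simp add: C_def T_sup flip: lessThan_Suc_atMost)
    also have "(\<Sum>m<n. a m * T m (Suc n)) = 0"
      by (simp add: T_zero)
    finally show ?thesis by simp
  qed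
  show ?thesis
  proof (cases n)
    \<comment> \<open>Both terms of index -1 are zero through \<open>zext\<close>, and there is no
      column before \<open>n\<close>.\<close>
    case 0
    have "C 0 = a 0 * T 0 0"
      by (simp add: C_def 0)
    then show ?thesis
      using K C_Suc by (simp add: 0 zext_def T_def)
  next
    case (Suc p)
    have Cn: "C n = a p + a n * T n n"
    proof -
      have "C n = (\<Sum>m<p. a m * T m n) + a p + a n * T n n"
        by (simp add: C_def Suc T_sup flip: lessThan_Suc_atMost)
      also have "(\<Sum>m<p. a m * T m n) = 0"
        by (simp add: T_zero Suc)
      finally show ?thesis by simp
    qed
    have Cp: "C p = - a (Suc n) * T (Suc n) p"
      using annih[of p "Suc n"] by (simp add: C_def Suc)
    have "C k = 0" if "k < p" for k
      unfolding C_def by (rule annih) (use that Suc in simp)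
    then have "(\<Sum>k<p. C k * typeII_B S k x) = 0"
      by simp
    then have "(\<Sum>k\<le>Suc n. C k * typeII_B S k x)
        = C p * typeII_B S p x + C n * typeII_B S n x + C (Suc n) * typeII_B S (Suc n) x"
      by (simp add: Suc flip: lessThan_Suc_atMost)
    then show ?thesis
      unfolding K Cp Cn C_Suc by (simp add: Suc zext_def T_def)
  qed
qed

section \<open>The swapped system of weights\<close>

text \<open>The integrands agree pointwise, by the index shift of \<open>X1vec\<close> and
  \<open>X2vec\<close>. All comparison of the two systems goes through this identity.\<close>

lemma moment_matrix_swapped:
  "moment_matrix \<Delta> \<mu> (swapped_weights w) i j = moment_matrix \<Delta> \<mu> w i (Suc j)"
  by (simp add: moment_matrix_def swapped_weights_def X1vec_Suc X2vec_Suc algebra_simps)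

lemma moment_matrix_Suc:
  "moment_matrix \<Delta> \<mu> w (Suc i) j = moment_matrix \<Delta> \<mu> w i (Suc (Suc j))"
  by (simp add: moment_matrix_def Xvec_def X1vec_Suc X2vec_Suc algebra_simps)

theorem theorem7:
  fixes \<Delta> :: "real set" and \<mu> :: "real measure" and w\<^sub>1 w\<^sub>2 :: "real \<Rightarrow> real"
    and w w' :: weight_pair
    and S St S' St' T :: smat and H H' :: svec
    and A\<^sub>1 A\<^sub>2 B Q A\<^sub>1' A\<^sub>2' B' Q' :: "nat \<Rightarrow> real \<Rightarrow> real"
    and K\<^sub>1 :: "nat \<Rightarrow> real \<Rightarrow> real \<Rightarrow> real"
  defines "w \<equiv> (w\<^sub>1, w\<^sub>2)" and "w' \<equiv> swapped_weights w"
  assumes "is_interval \<Delta>"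
    and "sets \<mu> = sets borel" and "emeasure \<mu> (UNIV - \<Delta>) = 0"
    and "finite_moments \<Delta> \<mu> w\<^sub>1" and "finite_moments \<Delta> \<mu> w\<^sub>2"
    and "gauss_borel (moment_matrix \<Delta> \<mu> w) S H St"
    and "gauss_borel (moment_matrix \<Delta> \<mu> w') S' H' St'"
  defines "B \<equiv> typeII_B S" and "A\<^sub>1 \<equiv> typeI_A1 H St" and "A\<^sub>2 \<equiv> typeI_A2 H St"
    and "Q \<equiv> typeI_Q w H St"
    and "B' \<equiv> typeII_B S'" and "A\<^sub>1' \<equiv> typeI_A1 H' St'" and "A\<^sub>2' \<equiv> typeI_A2 H' St'"
    and "Q' \<equiv> typeI_Q w' H' St'"
    and "T \<equiv> recurrence_mat S" and "K\<^sub>1 \<equiv> kernel_K1 S H St"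
  shows "\<forall>n.
      A\<^sub>1 n 0 \<noteq> 0 \<and>
      (\<forall>y. Q' n y = Q n y - A\<^sub>1 n 0 / A\<^sub>1 (n + 1) 0 * Q (n + 1) y) \<and>
      (\<forall>y. A\<^sub>1' n y = A\<^sub>2 n y - A\<^sub>1 n 0 / A\<^sub>1 (n + 1) 0 * A\<^sub>2 (n + 1) y) \<and>
      (\<forall>y. y \<noteq> 0 \<longrightarrow>
         A\<^sub>2' n y = 1 / y * (A\<^sub>1 n y - A\<^sub>1 n 0 / A\<^sub>1 (n + 1) 0 * A\<^sub>1 (n + 1) y)) \<and>
      (\<forall>x. B' n x = K\<^sub>1 (n + 1) x 0 / A\<^sub>1 n 0) \<and>
      (\<forall>x. x \<noteq> 0 \<longrightarrow>
         B' n x = 1 / x *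
           (B (n + 1) x
            + (zext (\<lambda>m. A\<^sub>1 m 0) (int n - 1) / A\<^sub>1 n 0 + T n n) * B n x
            - A\<^sub>1 (n + 1) 0 / A\<^sub>1 n 0 * zext (T (n + 1)) (int n - 1)
                * zext (\<lambda>m. B m x) (int n - 1))) \<and>
      H' n = - (A\<^sub>1 (n + 1) 0 / A\<^sub>1 n 0) * H (n + 1)"
proof -
  note gb = assms(8) and gb' = assms(9)
  note SD = gauss_borelD[OF gb] and SD' = gauss_borelD[OF gb']
  have shift: "moment_matrix \<Delta> \<mu> w' i j = moment_matrix \<Delta> \<mu> w i (Suc j)" for i j
    by (simp add: w'_def moment_matrix_swapped)
  define c where "c = (\<lambda>n. A\<^sub>1 n 0 / A\<^sub>1 (Suc n) 0)"
  have nz: "A\<^sub>1 n 0 \<noteq> 0" for n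
    unfolding A\<^sub>1_def by (rule typeI_A1_zero_nonzero[OF gb gb' shift])
  have row: "inverse (H' n) * St' n l
      = inverse (H n) * St n (Suc l) - c n * (inverse (H (Suc n)) * St (Suc n) (Suc l))" for n l
    using typeI_row_shifted[OF gb gb' shift] by (simp add: c_def A\<^sub>1_def)
  have A1': "A\<^sub>1' n y = A\<^sub>2 n y - c n * A\<^sub>2 (Suc n) y" for n y
  proof -
    \<comment> \<open>Hence extending the shifted sum down to index 0 adds nothing.\<close>
    have X: "X2vec y 0 = 0"
      by (simp add: X2vec_def)
    show ?thesis
      unfolding A\<^sub>1'_def A\<^sub>2_def typeI_A1_sum[OF SD'(2) order.refl] row
      by (simp add: typeI_A2_sum[OF SD(2), of _ "Suc n"] sum.atMost_Suc_shift X X2vec_Suc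
          left_diff_distrib sum_subtractf sum_distrib_left mult.assoc del: sum.atMost_Suc)
  qed
  \<comment> \<open>Kept free of division, so that the relation for \<open>Q'\<close> also holds at
    \<open>y = 0\<close>: there the second weight supplies the factor \<open>y\<close>.\<close>
  have A2': "y * A\<^sub>2' n y = A\<^sub>1 n y - c n * A\<^sub>1 (Suc n) y" for n y
  proof -
    have "y * A\<^sub>2' n y = (\<Sum>j\<le>n. inverse (H' n) * St' n j * X1vec y (Suc j))"
      by (simp add: A\<^sub>2'_def typeI_A2_sum[OF SD'(2) order.refl] X1vec_Suc sum_distrib_left mult_ac)
    \<comment> \<open>Unlike \<open>X2vec y 0\<close>, the entry \<open>X1vec y 0\<close> is 1, so
      the term at index 0 disappears only by the choice of \<open>c\<close>.\<close>
    moreover have "inverse (H n) * St n 0 - c n * (inverse (H (Suc n)) * St (Suc n) 0) = 0"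
      using nz[of "Suc n"] by (simp add: c_def A\<^sub>1_def typeI_A1_zero[OF SD(2)])
    moreover have "X1vec y 0 = 1"
      by (simp add: X1vec_def)
    ultimately show ?thesis
      unfolding A\<^sub>1_def row
      by (simp add: typeI_A1_sum[OF SD(2), of _ "Suc n"] sum.atMost_Suc_shift
          left_diff_distrib distrib_left sum_subtractf sum_distrib_left mult.assoc
          del: sum.atMost_Suc)
  qed
  have Q': "Q' n y = Q n y - c n * Q (Suc n) y" for n y
  proof -
    have "Q' n y = w\<^sub>2 y * A\<^sub>1' n y + w\<^sub>1 y * (y * A\<^sub>2' n y)"
      by (simp add: Q'_def w'_def w_def swapped_weights_def typeI_Q_def A\<^sub>1'_def A\<^sub>2'_def)
    then show ?thesis
      unfolding A1' A2' by (simp add: Q_def typeI_Q_def w_def A\<^sub>1_def A\<^sub>2_def algebra_simps)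
  qed
  have K: "A\<^sub>1 n 0 * B' n x = K\<^sub>1 (Suc n) x 0" for n x
    using typeII_B_shifted[OF gb gb' shift] by (simp add: A\<^sub>1_def B'_def K\<^sub>1_def)
  have B'_K: "B' n x = K\<^sub>1 (Suc n) x 0 / A\<^sub>1 n 0" for n x
    using K[of n x] nz[of n] by (simp add: field_simps)
  have B'_T: "B' n x = 1 / x *
      (B (Suc n) x + (zext (\<lambda>m. A\<^sub>1 m 0) (int n - 1) / A\<^sub>1 n 0 + T n n) * B n x
        - A\<^sub>1 (Suc n) 0 / A\<^sub>1 n 0 * zext (T (Suc n)) (int n - 1)
            * zext (\<lambda>m. B m x) (int n - 1))" if "x \<noteq> 0" for n x
  proof -
    have eq: "x * (A\<^sub>1 n 0 * B' n x) = A\<^sub>1 n 0 * B (Suc n) x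
        + (zext (\<lambda>m. A\<^sub>1 m 0) (int n - 1) + A\<^sub>1 n 0 * T n n) * B n x
        - A\<^sub>1 (Suc n) 0 * zext (T (Suc n)) (int n - 1) * zext (\<lambda>m. B m x) (int n - 1)"
      unfolding K unfolding K\<^sub>1_def A\<^sub>1_def B_def T_def
      by (rule kernel_K1_three_term[OF gb moment_matrix_Suc])
    have "B' n x = x * (A\<^sub>1 n 0 * B' n x) / (x * A\<^sub>1 n 0)"
      using that nz[of n] by simp
    also have "\<dots> = 1 / x *
        (B (Suc n) x + (zext (\<lambda>m. A\<^sub>1 m 0) (int n - 1) / A\<^sub>1 n 0 + T n n) * B n x
          - A\<^sub>1 (Suc n) 0 / A\<^sub>1 n 0 * zext (T (Suc n)) (int n - 1)
              * zext (\<lambda>m. B m x) (int n - 1))"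
      unfolding eq using that nz[of n] by (simp add: field_simps)
    finally show ?thesis .
  qed
  have H': "H' n = - (A\<^sub>1 (Suc n) 0 / A\<^sub>1 n 0) * H (Suc n)" for n
  proof -
    \<comment> \<open>The diagonal case \<open>l = n\<close> of \<open>row\<close>:
      \<open>St n (Suc n)\<close> is 0 and the other two entries are 1.\<close>
    have "inverse (H' n) = - c n * inverse (H (Suc n))"
      using row[of n n] SD(2) SD'(2) by (simp add: lower_unitriangular_zero)
    then have "H' n = inverse (- c n * inverse (H (Suc n)))"
      by (metis inverse_inverse_eq)
    then show ?thesis
      by (simp add: c_def field_simps)
  qed
  show ?thesis
  proof (intro allI conjI impI)
    fix n and y :: real
    assume "y \<noteq> 0"
    then show "A\<^sub>2' n y = 1 / y * (A\<^sub>1 n y - A\<^sub>1 n 0 / A\<^sub>1 (n + 1) 0 * A\<^sub>1 (n + 1) y)"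
      using A2'[of y n] by (simp add: c_def field_simps)
  qed (use nz Q' A1' B'_K B'_T H' in \<open>simp_all add: c_def\<close>)
qed

end
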